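(* Let $\mathbf{P}\in\mathcal{M}$. For any $\boldsymbol{\xi}_{\mathbf{P}}=(\boldsymbol{\xi}_{\mathbf{P}_1},\dots,\boldsymbol{\xi}_{\mathbf{P}_U})\in T_{\mathbf{P}}\mathcal{N}$, the orthogonal projection (with respect to $g^{\mathcal{N}}_{\mathbf{P}}$) of $\boldsymbol{\xi}_{\mathbf{P}}$ onto $T_{\mathbf{P}}\mathcal{M}$ is given by $$\boldsymbol{\Pi}^{T_{\mathbf{P}}\mathcal{N}}_{T_{\mathbf{P}}\mathcal{M}}(\boldsymbol{\xi}_{\mathbf{P}})=\Big(\boldsymbol{\xi}_{\mathbf{P}_1}-\sum_{\ell\in\mathcal{B}_1}\mu_\ell\mathbf{W}_1^H\mathbf{Q}_\ell\mathbf{W}_1\mathbf{P}_1,\ \cdots,\ \boldsymbol{\xi}_{\mathbf{P}_U}-\sum_{\ell\in\mathcal{B}_U}\mu_\ell\mathbf{W}_U^H\mathbf{Q}_\ell\mathbf{W}_U\mathbf{P}_U\Big),$$ where $$\mu_\ell=\frac{1}{P_\ell}\sum_{i\in\mathcal{U}_\ell}\Re\left\{\mathrm{tr}\left(\mathbf{P}_i^H\mathbf{W}_i^H\mathbf{Q}_\ell\mathbf{W}_i\boldsymbol{\xi}_{\mathbf{P}_i}\right)\right\}.$$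
   Context: Let $B,U,M_t$ and $d_1,\dots,d_U$ be positive integers. For each $i\in\{1,\dots,U\}$, $\mathcal{B}_i=\{i_1,\dots,i_{B_i}\}\subseteq\{1,\dots,B\}$ is a nonempty set with $B_i$ (distinct) elements. For each $k\in\{1,\dots,B\}$, $\mathcal{U}_k=\{i\in\{1,\dots,U\}: k\in\mathcal{B}_i\}$. The numbers $P_k>0$, $k\in\{1,\dots,B\}$, are given. $\mathcal{N}=\mathcal{N}_1\times\cdots\times\mathcal{N}_U$ with $\mathcal{N}_i=\mathbb{C}^{B_iM_t\times d_i}$, regarded as a real linear manifold, so $T_{\mathbf{P}}\mathcal{N}=\mathcal{N}$. A point is $\mathbf{P}=(\mathbf{P}_1,\dots,\mathbf{P}_U)$ with $\mathbf{P}_i=[\mathbf{P}_{i,i_1}^T,\dots,\mathbf{P}_{i,i_{B_i}}^T]^T\in\mathbb{C}^{B_iM_t\times d_i}$, $\mathbf{P}_{i,k}\in\mathbb{C}^{M_t\times d_i}$. The Riemannian metric on $\mathcal{N}$ is $g^{\mathcal{N}}_{\mathbf{P}}(\boldsymbol{\xi}_{\mathbf{P}},\boldsymbol{\zeta}_{\mathbf{P}})=\sum_{i=1}^{U}\Re\{\mathrm{tr}(\boldsymbol{\zeta}_{\mathbf{P}_i}^H\boldsymbol{\xi}_{\mathbf{P}_i})\}$. $\mathbf{W}_i\in\mathbb{R}^{BM_t\times B_iM_t}$ is the block matrix made of $B\times B_i$ blocks of size $M_t\times M_t$ whose $(i_n,n)$ block is $\mathbf{I}_{M_t}$ for $n=1,\dots,B_i$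 and whose other blocks are zero. $\mathbf{Q}_k\in\mathbb{C}^{BM_t\times BM_t}$ is the block diagonal matrix with $B$ diagonal blocks of size $M_t\times M_t$, whose $k$-th diagonal block is $\mathbf{I}_{M_t}$ and whose other blocks are zero. $\mathcal{M}$ is the Riemannian submanifold of $\mathcal{N}$ (with the induced metric) given by $$\mathcal{M}=\Big\{\mathbf{P}\in\mathcal{N}\ \Big|\ \sum_{i\in\mathcal{U}_k}\mathrm{tr}(\mathbf{P}_i^H\mathbf{W}_i^H\mathbf{Q}_k\mathbf{W}_i\mathbf{P}_i)=P_k,\ k=1,\dots,B\Big\},$$ whose tangent space at $\mathbf{P}\in\mathcal{M}$ is $$T_{\mathbf{P}}\mathcal{M}=\Big\{\boldsymbol{\xi}_{\mathbf{P}}\in T_{\mathbf{P}}\mathcal{N}\ \Big|\ \sum_{i\in\mathcal{U}_k}\mathrm{tr}\big(\boldsymbol{\xi}_{\mathbf{P}_i}^H\mathbf{W}_i^H\mathbf{Q}_k\mathbf{W}_i\mathbf{P}_i+\mathbf{P}_i^H\mathbf{W}_i^H\mathbf{Q}_k\mathbf{W}_i\boldsymbol{\xi}_{\mathbf{P}_i}\big)=0,\ k=1,\dots,B\Big\}.$$ *)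

theory Defs
  imports Complex_Main "HOL-Library.FuncSet" "Jordan_Normal_Form.Schur_Decomposition"
begin

text \<open>
  Indices \<open>i\<close> (in \<open>{1..U}\<close>) and \<open>k\<close> (in \<open>{1..B}\<close>) are 1-based, whereas matrix rows and columns
  are 0-based. The set \<open>\<B>\<^sub>i = {i\<^sub>1, \<dots>, i\<^sub>m}\<close> comes with a fixed enumeration, represented by the
  distinct list \<open>bs i = [i\<^sub>1, \<dots>, i\<^sub>m]\<close> of length \<open>m = B\<^sub>i\<close>. A point or tangent vector
  \<open>(\<xi>\<^sub>1, \<dots>, \<xi>\<^sub>U)\<close> is a function on \<open>{1..U}\<close> that is \<open>undefined\<close> elsewhere, so that equality
  of functions is equality of tuples.
\<close>

definition mat_trace :: "'a :: comm_monoid_add mat \<Rightarrow> 'a" where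
  "mat_trace A = (\<Sum>j<dim_row A. A $$ (j, j))"

text \<open>The matrix analogue of \<^const>\<open>finsum_vec\<close>.\<close>

definition finsum_mat ::
  "'a :: monoid_add itself \<Rightarrow> nat \<Rightarrow> nat \<Rightarrow> ('c \<Rightarrow> 'a mat) \<Rightarrow> 'c set \<Rightarrow> 'a mat" where
  "finsum_mat ty nr nc = finprod (monoid_mat ty nr nc)"

definition users :: "nat \<Rightarrow> (nat \<Rightarrow> nat list) \<Rightarrow> nat \<Rightarrow> nat set" where
  "users U bs k = {i \<in> {1..U}. k \<in> set (bs i)}"

text \<open>
  Entry \<open>(r, c)\<close> lies in the block \<open>(r div Mt + 1, c div Mt + 1)\<close>, at position
  \<open>(r mod Mt, c mod Mt)\<close> within it. The first argument of \<open>W_mat\<close> is the number \<open>B\<close>, the last one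
  the list \<open>[i\<^sub>1, \<dots>, i\<^sub>m]\<close>, whose 0-based entry \<open>c div Mt\<close> is the row block of the identity
  in column block \<open>c div Mt + 1\<close>.
\<close>

definition W_mat :: "nat \<Rightarrow> nat \<Rightarrow> nat list \<Rightarrow> complex mat" where
  "W_mat B Mt is = mat (B * Mt) (length is * Mt)
     (\<lambda>(r, c). if r div Mt + 1 = is ! (c div Mt) then 1\<^sub>m Mt $$ (r mod Mt, c mod Mt) else 0)"

definition Q_mat :: "nat \<Rightarrow> nat \<Rightarrow> nat \<Rightarrow> complex mat" where
  "Q_mat B Mt k = mat (B * Mt) (B * Mt)
     (\<lambda>(r, c). if r div Mt + 1 = k \<and> c div Mt + 1 = k then 1\<^sub>m Mt $$ (r mod Mt, c mod Mt) else 0)"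

text \<open>
  The ambient space \<open>\<N>\<close>; being linear, it is also its own tangent space at each of its points.
\<close>

definition ambient ::
  "nat \<Rightarrow> nat \<Rightarrow> (nat \<Rightarrow> nat list) \<Rightarrow> (nat \<Rightarrow> nat) \<Rightarrow> (nat \<Rightarrow> complex mat) set" where
  "ambient U Mt bs d = (\<Pi>\<^sub>E i\<in>{1..U}. carrier_mat (length (bs i) * Mt) (d i))"

definition metric :: "nat \<Rightarrow> (nat \<Rightarrow> complex mat) \<Rightarrow> (nat \<Rightarrow> complex mat) \<Rightarrow> real" where
  "metric U \<xi> \<zeta> = (\<Sum>i=1..U. Re (mat_trace (mat_adjoint (\<zeta> i) * \<xi> i)))"

definition power_manifold ::
  "nat \<Rightarrow> nat \<Rightarrow> nat \<Rightarrow> (nat \<Rightarrow> nat list) \<Rightarrow> (nat \<Rightarrow> nat) \<Rightarrow> (nat \<Rightarrow> real) \<Rightarrow> (nat \<Rightarrow> complex mat) set"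
  where
  "power_manifold B U Mt bs d Pw = {P \<in> ambient U Mt bs d. \<forall>k\<in>{1..B}.
     (\<Sum>i\<in>users U bs k. mat_trace (mat_adjoint (P i) * mat_adjoint (W_mat B Mt (bs i)) *
        Q_mat B Mt k * W_mat B Mt (bs i) * P i)) = complex_of_real (Pw k)}"

definition tangent_space ::
  "nat \<Rightarrow> nat \<Rightarrow> nat \<Rightarrow> (nat \<Rightarrow> nat list) \<Rightarrow> (nat \<Rightarrow> nat) \<Rightarrow> (nat \<Rightarrow> complex mat)
    \<Rightarrow> (nat \<Rightarrow> complex mat) set"
  where
  "tangent_space B U Mt bs d P = {\<xi> \<in> ambient U Mt bs d. \<forall>k\<in>{1..B}.
     (\<Sum>i\<in>users U bs k. mat_trace (
        mat_adjoint (\<xi> i) * mat_adjoint (W_mat B Mt (bs i)) * Q_mat B Mt k * W_mat B Mt (bs i) * P i +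
        mat_adjoint (P i) * mat_adjoint (W_mat B Mt (bs i)) * Q_mat B Mt k * W_mat B Mt (bs i) * \<xi> i))
     = 0}"

definition is_orth_proj ::
  "nat \<Rightarrow> (nat \<Rightarrow> complex mat) set \<Rightarrow> (nat \<Rightarrow> complex mat) \<Rightarrow> (nat \<Rightarrow> complex mat) \<Rightarrow> bool" where
  "is_orth_proj U T \<xi> \<eta> \<longleftrightarrow> \<eta> \<in> T \<and> (\<forall>\<zeta>\<in>T. metric U (\<lambda>i. \<xi> i - \<eta> i) \<zeta> = 0)"

text \<open>Only meaningful if the projection exists and is unique.\<close>

definition orth_proj ::
  "nat \<Rightarrow> (nat \<Rightarrow> complex mat) set \<Rightarrow> (nat \<Rightarrow> complex mat) \<Rightarrow> (nat \<Rightarrow> complex mat)" where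
  "orth_proj U T \<xi> = (THE \<eta>. is_orth_proj U T \<xi> \<eta>)"

end

theory Submission
  imports Defs
begin

text \<open>
  The matrix \<open>W\<^sub>i\<^sup>H Q\<^sub>k W\<^sub>i\<close> is the diagonal projection onto the rows of the
  block belonging to \<open>k\<close>. So in coordinates the constraints on \<open>P\<close> and on tangent vectors only
  involve the real bilinear forms \<open>b\<^sub>k\<close> (\<open>block_form\<close> below) that pair the blocks belonging to
  \<open>k\<close> over all \<open>i\<close>: they read \<open>b\<^sub>k(P, P) = P\<^sub>k\<close> and \<open>b\<^sub>k(P, \<xi>) = 0\<close>, while
  \<open>g = \<Sum>\<^sub>k b\<^sub>k\<close>. The claimed projection replaces the block \<open>\<xi>\<^sub>i\<^sub>,\<^sub>k\<close> by
  \<open>\<xi>\<^sub>i\<^sub>,\<^sub>k - \<mu>\<^sub>k P\<^sub>i\<^sub>,\<^sub>k\<close> with \<open>\<mu>\<^sub>k = b\<^sub>k(P, \<xi>) / P\<^sub>k\<close>, i.e. it is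
  an independent orthogonal projection for each \<open>k\<close>.
\<close>

section \<open>Adjoints and finite sums of matrices, entry by entry\<close>

lemma dim_mat_adjoint [simp]:
  "dim_row (mat_adjoint A) = dim_col A" "dim_col (mat_adjoint A) = dim_row A"
  by (simp_all add: mat_adjoint_def)

lemma mat_adjoint_carrier [simp]:
  "A \<in> carrier_mat n m \<Longrightarrow> mat_adjoint A \<in> carrier_mat m n"
  by (auto intro: carrier_matI)

lemma index_mat_adjoint [simp]:
  "i < dim_col A \<Longrightarrow> j < dim_row A \<Longrightarrow> mat_adjoint A $$ (i, j) = conjugate (A $$ (j, i))"
  by (simp add: mat_adjoint_def mat_of_rows_index)

lemma finsum_mat_closed:
  "f \<in> F \<rightarrow> carrier_mat nr nc \<Longrightarrow>
     finsum_mat TYPE('a :: comm_monoid_add) nr nc f F \<in> carrier_mat nr nc"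
  using comm_monoid.finprod_closed[OF comm_monoid_mat, of f F nr nc]
  by (simp add: finsum_mat_def monoid_mat_def)

text \<open>A \<open>finsum_mat\<close> is a \<open>finprod\<close> in the monoid of matrices of
  fixed size, whose insertion rule asks for membership in the carrier; this brings the sum of the
  theorem down to sums of complex numbers.\<close>

lemma index_finsum_mat:
  assumes "finite F" "i < nr" "j < nc" "f \<in> F \<rightarrow> carrier_mat nr nc"
  shows "finsum_mat TYPE('a :: comm_monoid_add) nr nc f F $$ (i, j) = (\<Sum>x\<in>F. f x $$ (i, j))"
  using assms(1,4)
proof (induct F)
  case empty
  then show ?case
    using comm_monoid.finprod_empty[OF comm_monoid_mat, of nr nc f] assms
    by (simp add: finsum_mat_def monoid_mat_def)
next
  case (insert x F)
  have c: "f \<in> F \<rightarrow> carrier_mat nr nc" "f x \<in> carrier_mat nr nc"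
    using insert by auto
  have "finsum_mat TYPE('a) nr nc f (insert x F) = f x + finsum_mat TYPE('a) nr nc f F"
    using comm_monoid.finprod_insert[OF comm_monoid_mat insert(1,2), of f nr nc] c
    by (simp add: finsum_mat_def monoid_mat_def)
  moreover have "finsum_mat TYPE('a) nr nc f F \<in> carrier_mat nr nc"
    by (rule finsum_mat_closed[OF c(1)])
  ultimately show ?case using insert c assms by simp
qed

section \<open>Selection matrices and the diagonal projection built from them\<close>

lemma W_mat_carrier [simp]: "W_mat B Mt is \<in> carrier_mat (B * Mt) (length is * Mt)"
  by (simp add: W_mat_def)

lemma Q_mat_carrier [simp]: "Q_mat B Mt k \<in> carrier_mat (B * Mt) (B * Mt)"
  by (simp add: Q_mat_def)

text \<open>An index is determined by its quotient and remainder modulo \<open>Mt\<close>, so equal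
  blocks and equal positions inside them amount to \<open>r = c\<close>.\<close>

lemma index_Q_mat:
  assumes "r < B * Mt" "c < B * Mt"
  shows "Q_mat B Mt k $$ (r, c) = (if r = c \<and> r div Mt + 1 = k then 1 else 0)"
proof -
  have "0 < Mt" using assms by (cases Mt) auto
  moreover have "r = c" if "r div Mt = c div Mt" "r mod Mt = c mod Mt"
    using that by (metis div_mult_mod_eq)
  ultimately show ?thesis using assms by (auto simp: Q_mat_def)
qed

text \<open>The only row in which column \<open>c\<close> of \<^const>\<open>W_mat\<close> is nonzero.\<close>

definition sel_row :: "nat \<Rightarrow> nat list \<Rightarrow> nat \<Rightarrow> nat" where
  "sel_row Mt is c = (is ! (c div Mt) - 1) * Mt + c mod Mt"

lemma block_index_less: "c < n * Mt \<Longrightarrow> c div Mt < (n :: nat)"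
  by (simp add: less_mult_imp_div_less)

lemma sel_row_less:
  assumes "set is \<subseteq> {1..B}" "c < length is * Mt"
  shows "sel_row Mt is c < B * Mt"
proof -
  have "is ! (c div Mt) \<in> {1..B}"
    using assms block_index_less[OF assms(2)] nth_mem by blast
  \<comment> \<open>Block numbers are 1-based; writing this one as \<open>Suc b\<close> removes the
    truncated subtraction in \<open>sel_row\<close>.\<close>
  then obtain b where b: "is ! (c div Mt) = Suc b" "b < B" 
    by (cases "is ! (c div Mt)") auto
  have "0 < Mt" using assms by (cases Mt) auto
  then have "sel_row Mt is c < Suc b * Mt" by (simp add: sel_row_def b)
  also have "\<dots> \<le> B * Mt" using b by (intro mult_le_mono1) simp
  finally show ?thesis .
qed

lemma sel_row_div:
  assumes "set is \<subseteq> {1..B}" "c < length is * Mt"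
  shows "sel_row Mt is c div Mt + 1 = is ! (c div Mt)"
proof -
  have "is ! (c div Mt) \<in> {1..B}"
    using assms block_index_less[OF assms(2)] nth_mem by blast
  moreover have "0 < Mt" using assms by (cases Mt) auto
  ultimately show ?thesis by (simp add: sel_row_def)
qed

text \<open>The quotient of \<open>sel_row\<close> gives the block number, which by distinctness of
  the list occurs at one position only; the remainder then fixes the column inside the
  block.\<close>

lemma sel_row_inj:
  assumes "set is \<subseteq> {1..B}" "distinct is" "a < length is * Mt" "c < length is * Mt"
    and "sel_row Mt is a = sel_row Mt is c"
  shows "a = c"
proof -
  have "is ! (a div Mt) = is ! (c div Mt)"
    using sel_row_div[OF assms(1,3)] sel_row_div[OF assms(1,4)] assms(5) by simp
  then have "a div Mt = c div Mt"
    using assms block_index_less nth_eq_iff_index_eq by metis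
  moreover have "a mod Mt = c mod Mt"
    using assms(5) by (simp add: sel_row_def \<open>is ! (a div Mt) = is ! (c div Mt)\<close>)
  ultimately show ?thesis by (metis div_mult_mod_eq)
qed

lemma index_W_mat:
  assumes "set is \<subseteq> {1..B}" "r < B * Mt" "c < length is * Mt"
  shows "W_mat B Mt is $$ (r, c) = (if r = sel_row Mt is c then 1 else 0)"
proof -
  have "0 < Mt" using assms by (cases Mt) auto
  have iff: "r div Mt + 1 = is ! (c div Mt) \<and> r mod Mt = c mod Mt \<longleftrightarrow> r = sel_row Mt is c"
  proof
    assume "r div Mt + 1 = is ! (c div Mt) \<and> r mod Mt = c mod Mt"
    then show "r = sel_row Mt is c"
      unfolding sel_row_def by (metis add_diff_cancel_right' div_mult_mod_eq)
  next
    assume r: "r = sel_row Mt is c"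
    show "r div Mt + 1 = is ! (c div Mt) \<and> r mod Mt = c mod Mt"
      unfolding r using sel_row_div[OF assms(1,3)] by (simp add: sel_row_def)
  qed
  have "W_mat B Mt is $$ (r, c) =
      (if r div Mt + 1 = is ! (c div Mt) \<and> r mod Mt = c mod Mt then 1 else 0)"
    using assms(2,3) \<open>0 < Mt\<close> by (simp add: W_mat_def del: One_nat_def)
  also have "\<dots> = (if r = sel_row Mt is c then 1 else 0)"
    by (simp only: iff)
  finally show ?thesis .
qed

text \<open>Column \<open>a\<close> of \<open>W_mat\<close> is the unit vector at
  \<open>sel_row Mt is a\<close>, so the product has at \<open>(a, c)\<close> the entry of
  \<open>Q_mat\<close> at the two selected rows. As \<open>Q_mat\<close> is diagonal and
  \<open>sel_row\<close> is injective, only \<open>a = c\<close> survives.\<close>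

lemma W_adjoint_Q_W:
  assumes "set is \<subseteq> {1..B}" "distinct is"
  shows "mat_adjoint (W_mat B Mt is) * Q_mat B Mt k * W_mat B Mt is =
    mat (length is * Mt) (length is * Mt) (\<lambda>(a, c). if a = c \<and> is ! (a div Mt) = k then 1 else 0)"
    (is "?L = ?R")
proof (rule eq_matI)
  fix a c assume "a < dim_row ?R" "c < dim_col ?R"
  then have a: "a < length is * Mt" and c: "c < length is * Mt" by auto
  let ?W = "W_mat B Mt is" and ?Q = "Q_mat B Mt k"
  have dims: "dim_row ?W = B * Mt" "dim_col ?W = length is * Mt"
     "dim_row ?Q = B * Mt" "dim_col ?Q = B * Mt"
    by (simp_all add: W_mat_def Q_mat_def)
  have WQ: "(mat_adjoint ?W * ?Q) $$ (a, s) =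
      (if s = sel_row Mt is a \<and> s div Mt + 1 = k then 1 else 0)" if s: "s < B * Mt" for s
  proof -
    have "(mat_adjoint ?W * ?Q) $$ (a, s) =
        (\<Sum>r<B * Mt. conjugate (?W $$ (r, a)) * ?Q $$ (r, s))"
      using a s dims by (simp add: scalar_prod_def lessThan_atLeast0)
    \<comment> \<open>Both factors are indicators; a test \<open>r = s\<close> in front lets the sum
      collapse to one term.\<close>
    also have "\<dots> = (\<Sum>r<B * Mt. if r = s then
        (if s = sel_row Mt is a \<and> s div Mt + 1 = k then 1 else 0) else 0)"
      by (rule sum.cong) (auto simp: index_W_mat[OF assms(1) _ a] index_Q_mat s)
    finally show ?thesis using s by simp
  qed
  have "?L $$ (a, c) = (\<Sum>s<B * Mt. (mat_adjoint ?W * ?Q) $$ (a, s) * ?W $$ (s, c))"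
    using a c dims by (simp add: scalar_prod_def lessThan_atLeast0 del: index_mult_mat(1))
       (simp add: scalar_prod_def)
  also have "\<dots> = (\<Sum>s<B * Mt. if s = sel_row Mt is a then
        (if sel_row Mt is a = sel_row Mt is c \<and> sel_row Mt is a div Mt + 1 = k then 1 else 0) else 0)"
    by (rule sum.cong) (auto simp: index_W_mat[OF assms(1) _ c] WQ)
  also have "\<dots> = (if a = c \<and> is ! (a div Mt) = k then 1 else 0)"
    using sel_row_less[OF assms(1) a] sel_row_div[OF assms(1) a] sel_row_inj[OF assms a c] by auto
  finally show "?L $$ (a, c) = ?R $$ (a, c)" using a c by simp
qed (simp_all add: W_mat_def)

lemma index_W_adjoint_Q_W_mult:
  assumes "set is \<subseteq> {1..B}" "distinct is" "X \<in> carrier_mat (length is * Mt) m"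
    and "r < length is * Mt" "j < m"
  shows "(mat_adjoint (W_mat B Mt is) * Q_mat B Mt k * W_mat B Mt is * X) $$ (r, j) =
    (if is ! (r div Mt) = k then X $$ (r, j) else 0)"
proof -
  have "(mat_adjoint (W_mat B Mt is) * Q_mat B Mt k * W_mat B Mt is * X) $$ (r, j) =
      (\<Sum>s<length is * Mt. (if r = s \<and> is ! (r div Mt) = k then 1 else 0) * X $$ (s, j))"
    unfolding W_adjoint_Q_W[OF assms(1,2)] using assms(3-5)
    by (simp add: scalar_prod_def lessThan_atLeast0)
  also have "\<dots> = (\<Sum>s<length is * Mt. if s = r then
       (if is ! (r div Mt) = k then X $$ (r, j) else 0) else 0)"
    by (rule sum.cong) auto
  finally show ?thesis using assms by simp
qed

section \<open>Traces as sums over entries, and the block forms\<close>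

lemma trace_adjoint_mult:
  fixes A X :: "complex mat"
  assumes "A \<in> carrier_mat n m" "X \<in> carrier_mat n m"
  shows "mat_trace (mat_adjoint A * X) = (\<Sum>j<m. \<Sum>r<n. cnj (A $$ (r, j)) * X $$ (r, j))"
  using assms by (simp add: mat_trace_def scalar_prod_def lessThan_atLeast0)

lemma trace_adjoint_W_Q_W:
  assumes "set is \<subseteq> {1..B}" "distinct is"
    and "A \<in> carrier_mat (length is * Mt) m" "X \<in> carrier_mat (length is * Mt) m"
  shows "mat_trace (mat_adjoint A * mat_adjoint (W_mat B Mt is) * Q_mat B Mt k * W_mat B Mt is * X)
    = (\<Sum>j<m. \<Sum>r<length is * Mt.
         if is ! (r div Mt) = k then cnj (A $$ (r, j)) * X $$ (r, j) else 0)"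
proof -
  let ?n = "length is * Mt"
  let ?W = "W_mat B Mt is" and ?Q = "Q_mat B Mt k"
  have WH: "mat_adjoint ?W \<in> carrier_mat ?n (B * Mt)" by (intro mat_adjoint_carrier W_mat_carrier)
  have AH: "mat_adjoint A \<in> carrier_mat m ?n" using assms by simp
  have WQ: "mat_adjoint ?W * ?Q \<in> carrier_mat ?n (B * Mt)"
    using WH Q_mat_carrier by (rule mult_carrier_mat)
  have WQW: "mat_adjoint ?W * ?Q * ?W \<in> carrier_mat ?n ?n"
    using WQ W_mat_carrier by (rule mult_carrier_mat)
  \<comment> \<open>The product is parsed from the left; reassociating isolates the diagonal
    projection applied to \<open>X\<close>, which leaves a Frobenius inner product with
    \<open>A\<close>.\<close>
  have "mat_adjoint A * mat_adjoint ?W * ?Q * ?W * X = mat_adjoint A * (mat_adjoint ?W * ?Q * ?W * X)"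
    by (simp add: assoc_mult_mat[OF AH WH Q_mat_carrier] assoc_mult_mat[OF AH WQ W_mat_carrier]
        assoc_mult_mat[OF AH WQW assms(4)])
  moreover have "mat_adjoint ?W * ?Q * ?W * X \<in> carrier_mat ?n m"
    using WQW assms(4) by (rule mult_carrier_mat)
  ultimately show ?thesis
    using assms(3) by (simp add: trace_adjoint_mult)
      (intro sum.cong refl, simp add: index_W_adjoint_Q_W_mult[OF assms(1,2,4)] del: index_mult_mat(1))
qed

text \<open>The sum runs over all \<open>i\<close> rather than \<open>users U bs k\<close>, with
  \<open>k\<close> occurring only in the innermost test. The index ranges are thus independent of
  \<open>k\<close>, which allows sums over \<open>k\<close> to be interchanged with the
  others.\<close>

definition block_form ::
  "nat \<Rightarrow> nat \<Rightarrow> (nat \<Rightarrow> nat list) \<Rightarrow> (nat \<Rightarrow> nat) \<Rightarrow> nat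
    \<Rightarrow> (nat \<Rightarrow> complex mat) \<Rightarrow> (nat \<Rightarrow> complex mat) \<Rightarrow> real" where
  "block_form U Mt bs d k A X = (\<Sum>i=1..U. \<Sum>j<d i. \<Sum>r<length (bs i) * Mt.
     if bs i ! (r div Mt) = k then Re (cnj (A i $$ (r, j)) * X i $$ (r, j)) else 0)"

lemma block_form_commute: "block_form U Mt bs d k A X = block_form U Mt bs d k X A"
  unfolding block_form_def by (intro sum.cong refl) (simp add: mult.commute)

lemma ambient_carrier:
  "X \<in> ambient U Mt bs d \<Longrightarrow> i \<in> {1..U} \<Longrightarrow> X i \<in> carrier_mat (length (bs i) * Mt) (d i)"
  unfolding ambient_def by (rule PiE_mem)

lemma ambient_Pi:
  "X \<in> ambient U Mt bs d \<Longrightarrow> X \<in> (\<Pi> i\<in>{1..U}. carrier_mat (length (bs i) * Mt) (d i))"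
  unfolding ambient_def PiE_def by blast

text \<open>For \<open>i\<close> outside \<open>users U bs k\<close> no row lies in a block numbered
  \<open>k\<close>, so extending the sum from the users to all of \<open>{1..U}\<close> adds only
  zeros.\<close>

lemma block_form_trace:
  assumes "\<And>i. i \<in> {1..U} \<Longrightarrow> distinct (bs i)"
    and "\<And>i. i \<in> {1..U} \<Longrightarrow> set (bs i) \<subseteq> {1..B}"
    and "A \<in> ambient U Mt bs d" "X \<in> ambient U Mt bs d"
  shows "(\<Sum>i\<in>users U bs k. Re (mat_trace (mat_adjoint (A i) * mat_adjoint (W_mat B Mt (bs i)) *
              Q_mat B Mt k * W_mat B Mt (bs i) * X i))) = block_form U Mt bs d k A X"
proof -
  have "block_form U Mt bs d k A X = (\<Sum>i\<in>users U bs k. \<Sum>j<d i. \<Sum>r<length (bs i) * Mt.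
     if bs i ! (r div Mt) = k then Re (cnj (A i $$ (r, j)) * X i $$ (r, j)) else 0)"
    unfolding block_form_def
  proof (rule sum.mono_neutral_right)
    show "\<forall>i\<in>{1..U} - users U bs k. (\<Sum>j<d i. \<Sum>r<length (bs i) * Mt.
     if bs i ! (r div Mt) = k then Re (cnj (A i $$ (r, j)) * X i $$ (r, j)) else 0) = 0"
    proof (intro ballI sum.neutral)
      fix i j r assume "i \<in> {1..U} - users U bs k" "r \<in> {..<length (bs i) * Mt}"
      then have "k \<notin> set (bs i)" "r div Mt < length (bs i)"
        by (auto simp: users_def less_mult_imp_div_less)
      then show "(if bs i ! (r div Mt) = k then Re (cnj (A i $$ (r, j)) * X i $$ (r, j)) else 0) = 0"
        by (metis nth_mem)
    qed
  qed (auto simp: users_def)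
  also have "\<dots> = (\<Sum>i\<in>users U bs k. Re (mat_trace (mat_adjoint (A i) *
      mat_adjoint (W_mat B Mt (bs i)) * Q_mat B Mt k * W_mat B Mt (bs i) * X i)))"
  proof (rule sum.cong[OF refl])
    fix i assume "i \<in> users U bs k"
    then have i: "i \<in> {1..U}" by (simp add: users_def)
    show "(\<Sum>j<d i. \<Sum>r<length (bs i) * Mt.
        if bs i ! (r div Mt) = k then Re (cnj (A i $$ (r, j)) * X i $$ (r, j)) else 0) =
      Re (mat_trace (mat_adjoint (A i) *
      mat_adjoint (W_mat B Mt (bs i)) * Q_mat B Mt k * W_mat B Mt (bs i) * X i))"
      unfolding trace_adjoint_W_Q_W[OF assms(2)[OF i] assms(1)[OF i]
          ambient_carrier[OF assms(3) i] ambient_carrier[OF assms(4) i]] Re_sum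
      by (intro sum.cong refl) simp
  qed
  finally show ?thesis by simp
qed

text \<open>The two traces in the constraint are complex conjugates of each other, since the
  projection between the factors is real and diagonal. Their sum is twice a real part, so each
  complex equation is a single real one.\<close>

lemma tangent_space_iff:
  assumes "\<And>i. i \<in> {1..U} \<Longrightarrow> distinct (bs i)"
    and "\<And>i. i \<in> {1..U} \<Longrightarrow> set (bs i) \<subseteq> {1..B}"
    and "P \<in> ambient U Mt bs d"
  shows "\<xi> \<in> tangent_space B U Mt bs d P \<longleftrightarrow>
    \<xi> \<in> ambient U Mt bs d \<and> (\<forall>k\<in>{1..B}. block_form U Mt bs d k P \<xi> = 0)"
proof (cases "\<xi> \<in> ambient U Mt bs d")
  case True
  have "(\<Sum>i\<in>users U bs k. mat_trace (
        mat_adjoint (\<xi> i) * mat_adjoint (W_mat B Mt (bs i)) * Q_mat B Mt k * W_mat B Mt (bs i) * P i +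
        mat_adjoint (P i) * mat_adjoint (W_mat B Mt (bs i)) * Q_mat B Mt k * W_mat B Mt (bs i) * \<xi> i))
     = complex_of_real (2 * block_form U Mt bs d k P \<xi>)" for k
  proof -
    let ?t = "\<lambda>A X i. mat_trace (mat_adjoint (A i) * mat_adjoint (W_mat B Mt (bs i)) *
        Q_mat B Mt k * W_mat B Mt (bs i) * X i)"
    have "mat_trace (
        mat_adjoint (\<xi> i) * mat_adjoint (W_mat B Mt (bs i)) * Q_mat B Mt k * W_mat B Mt (bs i) * P i +
        mat_adjoint (P i) * mat_adjoint (W_mat B Mt (bs i)) * Q_mat B Mt k * W_mat B Mt (bs i) * \<xi> i)
      = complex_of_real (2 * Re (?t P \<xi> i))" if "i \<in> users U bs k" for i
    proof -
      have i: "i \<in> {1..U}" using that by (simp add: users_def)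
      note P = ambient_carrier[OF assms(3) i] and \<xi> = ambient_carrier[OF True i]
      have "?t \<xi> P i = cnj (?t P \<xi> i)"
        unfolding trace_adjoint_W_Q_W[OF assms(2)[OF i] assms(1)[OF i] P \<xi>]
          trace_adjoint_W_Q_W[OF assms(2)[OF i] assms(1)[OF i] \<xi> P] cnj_sum
        by (intro sum.cong refl) simp
      moreover have "mat_trace (
        mat_adjoint (\<xi> i) * mat_adjoint (W_mat B Mt (bs i)) * Q_mat B Mt k * W_mat B Mt (bs i) * P i +
        mat_adjoint (P i) * mat_adjoint (W_mat B Mt (bs i)) * Q_mat B Mt k * W_mat B Mt (bs i) * \<xi> i)
        = ?t \<xi> P i + ?t P \<xi> i"
        using P \<xi> by (simp add: mat_trace_def sum.distrib del: index_mult_mat(1))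
      ultimately show ?thesis
        by (simp add: complex_add_cnj add.commute)
    qed
    then have "(\<Sum>i\<in>users U bs k. mat_trace (
        mat_adjoint (\<xi> i) * mat_adjoint (W_mat B Mt (bs i)) * Q_mat B Mt k * W_mat B Mt (bs i) * P i +
        mat_adjoint (P i) * mat_adjoint (W_mat B Mt (bs i)) * Q_mat B Mt k * W_mat B Mt (bs i) * \<xi> i))
      = (\<Sum>i\<in>users U bs k. complex_of_real (2 * Re (?t P \<xi> i)))"
      by (rule sum.cong[OF refl])
    also have "\<dots> = complex_of_real (2 * (\<Sum>i\<in>users U bs k. Re (?t P \<xi> i)))"
      by (simp add: sum_distrib_left)
    finally show ?thesis
      by (simp only: block_form_trace[OF assms(1,2,3) True])
  qed
  then show ?thesis using True by (simp add: tangent_space_def)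
qed (simp add: tangent_space_def)

lemma power_manifold_block_form:
  assumes "\<And>i. i \<in> {1..U} \<Longrightarrow> distinct (bs i)"
    and "\<And>i. i \<in> {1..U} \<Longrightarrow> set (bs i) \<subseteq> {1..B}"
    and "P \<in> power_manifold B U Mt bs d Pw" "k \<in> {1..B}"
  shows "block_form U Mt bs d k P P = Pw k"
proof -
  have "P \<in> ambient U Mt bs d" using assms(3) by (simp add: power_manifold_def)
  note block_form_trace[OF assms(1,2) this this, of k, symmetric]
  also have "(\<Sum>i\<in>users U bs k. Re (mat_trace (mat_adjoint (P i) * mat_adjoint (W_mat B Mt (bs i)) *
              Q_mat B Mt k * W_mat B Mt (bs i) * P i))) = Re (complex_of_real (Pw k))"
    using assms(3,4) unfolding power_manifold_def Re_sum[symmetric] by auto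
  finally show ?thesis by simp
qed

section \<open>The metric and uniqueness of orthogonal projections\<close>

text \<open>The hypotheses use \<open>\<Pi>\<close> instead of the extensional product because the
  differences fed to \<open>metric\<close> in \<open>is_orth_proj\<close> are not restricted to
  \<open>{1..U}\<close>.\<close>

lemma metric_entries:
  assumes "\<xi> \<in> (\<Pi> i\<in>{1..U}. carrier_mat (n i) (m i))"
    and "\<zeta> \<in> (\<Pi> i\<in>{1..U}. carrier_mat (n i) (m i))"
  shows "metric U \<xi> \<zeta> = (\<Sum>i=1..U. \<Sum>j<m i. \<Sum>r<n i. Re (cnj (\<zeta> i $$ (r, j)) * \<xi> i $$ (r, j)))"
  unfolding metric_def
proof (rule sum.cong[OF refl])
  fix i assume i: "i \<in> {1..U}"
  show "Re (mat_trace (mat_adjoint (\<zeta> i) * \<xi> i)) =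
      (\<Sum>j<m i. \<Sum>r<n i. Re (cnj (\<zeta> i $$ (r, j)) * \<xi> i $$ (r, j)))"
    unfolding trace_adjoint_mult[OF Pi_mem[OF assms(2) i] Pi_mem[OF assms(1) i]] Re_sum ..
qed

lemma metric_diff_left:
  assumes "\<xi> \<in> (\<Pi> i\<in>{1..U}. carrier_mat (n i) (m i))"
    and "\<xi>' \<in> (\<Pi> i\<in>{1..U}. carrier_mat (n i) (m i))"
    and "\<zeta> \<in> (\<Pi> i\<in>{1..U}. carrier_mat (n i) (m i))"
  shows "metric U (\<lambda>i. \<xi> i - \<xi>' i) \<zeta> = metric U \<xi> \<zeta> - metric U \<xi>' \<zeta>"
proof -
  have "(\<lambda>i. \<xi> i - \<xi>' i) \<in> (\<Pi> i\<in>{1..U}. carrier_mat (n i) (m i))"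
    using minus_carrier_mat[OF Pi_mem[OF assms(2)]] by simp
  note m = metric_entries[OF this assms(3)] metric_entries[OF assms(1,3)] metric_entries[OF assms(2,3)]
  show ?thesis
    unfolding m sum_subtractf[symmetric]
  proof (intro sum.cong refl)
    fix i j r assume "i \<in> {1..U}" "j \<in> {..<m i}" "r \<in> {..<n i}"
    then have "(\<xi> i - \<xi>' i) $$ (r, j) = \<xi> i $$ (r, j) - \<xi>' i $$ (r, j)"
      using Pi_mem[OF assms(2), of i] by simp
    then show "Re (cnj (\<zeta> i $$ (r, j)) * (\<xi> i - \<xi>' i) $$ (r, j)) =
        Re (cnj (\<zeta> i $$ (r, j)) * \<xi> i $$ (r, j)) - Re (cnj (\<zeta> i $$ (r, j)) * \<xi>' i $$ (r, j))"
      by (simp only: right_diff_distrib minus_complex.sel)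
  qed
qed

text \<open>Positive definiteness: the metric of a tuple with itself is a sum of squared moduli. The
  three nested sums are peeled off one at a time by nonnegativity.\<close>

lemma metric_self_zeroD:
  assumes "\<xi> \<in> (\<Pi> i\<in>{1..U}. carrier_mat (n i) (m i))"
    and "metric U \<xi> \<xi> = 0" and i: "i \<in> {1..U}" "r < n i" "j < m i"
  shows "\<xi> i $$ (r, j) = 0"
proof -
  let ?f = "\<lambda>i j r. Re (cnj (\<xi> i $$ (r, j)) * \<xi> i $$ (r, j))"
  have f: "?f i j r = (cmod (\<xi> i $$ (r, j)))\<^sup>2" for i j r
    by (simp add: cmod_power2) (simp add: power2_eq_square)
  have "(\<Sum>i=1..U. \<Sum>j<m i. \<Sum>r<n i. ?f i j r) = 0"
    using metric_entries[OF assms(1,1)] assms(2) by simp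
  then have "(\<Sum>j<m i. \<Sum>r<n i. ?f i j r) = 0"
    unfolding f by (subst (asm) sum_nonneg_eq_0_iff) (use i in \<open>auto intro!: sum_nonneg\<close>)
  then have "(\<Sum>r<n i. ?f i j r) = 0"
    unfolding f by (subst (asm) sum_nonneg_eq_0_iff) (use i in \<open>auto intro!: sum_nonneg\<close>)
  then have "?f i j r = 0"
    unfolding f by (subst (asm) sum_nonneg_eq_0_iff) (use i in \<open>auto intro!: sum_nonneg\<close>)
  then show ?thesis unfolding f by simp
qed

text \<open>The difference of two projections lies in \<open>T\<close> and is orthogonal to
  \<open>T\<close>, hence to itself, and positive definiteness makes it vanish.\<close>

lemma is_orth_proj_unique:
  assumes T: "T \<subseteq> ambient U Mt bs d"
    and diff: "\<And>\<eta> \<eta>'. \<eta> \<in> T \<Longrightarrow> \<eta>' \<in> T \<Longrightarrow> (\<lambda>i\<in>{1..U}. \<eta> i - \<eta>' i) \<in> T"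
    and \<xi>: "\<xi> \<in> ambient U Mt bs d"
    and "is_orth_proj U T \<xi> \<eta>" "is_orth_proj U T \<xi> \<eta>'"
  shows "\<eta> = \<eta>'"
proof -
  have \<eta>: "\<eta> \<in> T" "\<eta>' \<in> T" using assms by (auto simp: is_orth_proj_def)
  \<comment> \<open>Restriction makes the difference extensional, as membership in \<open>T\<close>
    demands; \<open>metric\<close> reads only the indices in \<open>{1..U}\<close>, so its values
    are unaffected.\<close>
  define \<delta> where "\<delta> = (\<lambda>i\<in>{1..U}. \<eta> i - \<eta>' i)"
  have \<delta>: "\<delta> \<in> T" using diff \<eta> by (simp add: \<delta>_def)
  note c = ambient_Pi[OF subsetD[OF T \<eta>(1)]] ambient_Pi[OF subsetD[OF T \<eta>(2)]]
    ambient_Pi[OF subsetD[OF T \<delta>]] ambient_Pi[OF \<xi>]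
  have "metric U (\<lambda>i. \<xi> i - \<eta> i) \<delta> = 0" "metric U (\<lambda>i. \<xi> i - \<eta>' i) \<delta> = 0"
    using assms \<delta> by (auto simp: is_orth_proj_def)
  then have "metric U \<eta> \<delta> = metric U \<eta>' \<delta>"
    unfolding metric_diff_left[OF c(4,1,3)] metric_diff_left[OF c(4,2,3)] by simp
  then have "metric U (\<lambda>i. \<eta> i - \<eta>' i) \<delta> = 0"
    unfolding metric_diff_left[OF c(1,2,3)] by simp
  moreover have "metric U (\<lambda>i. \<eta> i - \<eta>' i) \<delta> = metric U \<delta> \<delta>"
    by (simp add: metric_def \<delta>_def)
  ultimately have zero: "metric U \<delta> \<delta> = 0" by simp
  have "\<eta> i = \<eta>' i" if i: "i \<in> {1..U}" for i
  proof (rule eq_matI)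
    fix r j assume "r < dim_row (\<eta>' i)" "j < dim_col (\<eta>' i)"
    then have rj: "r < length (bs i) * Mt" "j < d i" using Pi_mem[OF c(2) i] by auto
    have "\<delta> i $$ (r, j) = 0"
      using c(3) zero i rj by (rule metric_self_zeroD)
    then show "\<eta> i $$ (r, j) = \<eta>' i $$ (r, j)"
      using rj i Pi_mem[OF c(1) i] Pi_mem[OF c(2) i] by (simp add: \<delta>_def)
  qed (use Pi_mem[OF c(1) i] Pi_mem[OF c(2) i] in auto)
  then show ?thesis
    using subsetD[OF T \<eta>(1)] subsetD[OF T \<eta>(2)] unfolding ambient_def by (intro PiE_ext)
qed

text \<open>Serves twice: to evaluate the constraints at the claimed projection, and to close the
  tangent space under differences, as uniqueness requires.\<close>

lemma block_form_diff_right: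
  assumes "X \<in> (\<Pi> i\<in>{1..U}. carrier_mat (length (bs i) * Mt) (d i))"
    and "Y \<in> (\<Pi> i\<in>{1..U}. carrier_mat (length (bs i) * Mt) (d i))"
  shows "block_form U Mt bs d k A (\<lambda>i\<in>{1..U}. X i - Y i) =
    block_form U Mt bs d k A X - block_form U Mt bs d k A Y"
proof -
  have "block_form U Mt bs d k A (\<lambda>i\<in>{1..U}. X i - Y i) =
    (\<Sum>i=1..U. \<Sum>j<d i. \<Sum>r<length (bs i) * Mt.
      (if bs i ! (r div Mt) = k then Re (cnj (A i $$ (r, j)) * X i $$ (r, j)) else 0) -
      (if bs i ! (r div Mt) = k then Re (cnj (A i $$ (r, j)) * Y i $$ (r, j)) else 0))"
    unfolding block_form_def
  proof (rule sum.cong[OF refl], rule sum.cong[OF refl], rule sum.cong[OF refl])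
    fix i j r assume i: "i \<in> {1..U}" and "j \<in> {..<d i}" "r \<in> {..<length (bs i) * Mt}"
    then have *: "(X i - Y i) $$ (r, j) = X i $$ (r, j) - Y i $$ (r, j)"
      using Pi_mem[OF assms(2) i] by simp
    have "Re (cnj (A i $$ (r, j)) * (\<lambda>i\<in>{1..U}. X i - Y i) i $$ (r, j)) =
      Re (cnj (A i $$ (r, j)) * X i $$ (r, j)) - Re (cnj (A i $$ (r, j)) * Y i $$ (r, j))"
      unfolding restrict_apply'[OF i] * right_diff_distrib minus_complex.sel ..
    then show "(if bs i ! (r div Mt) = k
        then Re (cnj (A i $$ (r, j)) * (\<lambda>i\<in>{1..U}. X i - Y i) i $$ (r, j)) else 0) =
      (if bs i ! (r div Mt) = k then Re (cnj (A i $$ (r, j)) * X i $$ (r, j)) else 0) -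
      (if bs i ! (r div Mt) = k then Re (cnj (A i $$ (r, j)) * Y i $$ (r, j)) else 0)"
      by (cases "bs i ! (r div Mt) = k") (simp_all only: if_True if_False diff_self simp_thms)
  qed
  then show ?thesis by (simp only: block_form_def sum_subtractf)
qed

section \<open>The projection formula\<close>

theorem lemma1:
  fixes B U Mt :: nat
    and d :: "nat \<Rightarrow> nat"
    and bs :: "nat \<Rightarrow> nat list"
    and Pw \<mu> :: "nat \<Rightarrow> real"
    and P \<xi> :: "nat \<Rightarrow> complex mat"
  assumes "B > 0" and "U > 0" and "Mt > 0"
    and "\<And>i. i \<in> {1..U} \<Longrightarrow> d i > 0"
    and "\<And>i. i \<in> {1..U} \<Longrightarrow> bs i \<noteq> []"
    and "\<And>i. i \<in> {1..U} \<Longrightarrow> distinct (bs i)"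
    and "\<And>i. i \<in> {1..U} \<Longrightarrow> set (bs i) \<subseteq> {1..B}"
    and "\<And>k. k \<in> {1..B} \<Longrightarrow> Pw k > 0"
    and "P \<in> power_manifold B U Mt bs d Pw"
    and "\<xi> \<in> ambient U Mt bs d"
    and "\<And>l. l \<in> {1..B} \<Longrightarrow> \<mu> l = 1 / Pw l *
           (\<Sum>i\<in>users U bs l. Re (mat_trace (mat_adjoint (P i) * mat_adjoint (W_mat B Mt (bs i)) *
              Q_mat B Mt l * W_mat B Mt (bs i) * \<xi> i)))"
  shows "(\<exists>!\<eta>. is_orth_proj U (tangent_space B U Mt bs d P) \<xi> \<eta>) \<and>
    orth_proj U (tangent_space B U Mt bs d P) \<xi> =
      (\<lambda>i\<in>{1..U}. \<xi> i - finsum_mat TYPE(complex) (length (bs i) * Mt) (d i)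
         (\<lambda>l. complex_of_real (\<mu> l) \<cdot>\<^sub>m
            (mat_adjoint (W_mat B Mt (bs i)) * Q_mat B Mt l * W_mat B Mt (bs i) * P i))
         (set (bs i)))"
proof -
  note dist = assms(6) and sub = assms(7) and \<xi> = assms(10)
  let ?T = "tangent_space B U Mt bs d P"
  have P: "P \<in> ambient U Mt bs d" using assms(9) by (simp add: power_manifold_def)
  have T_iff: "X \<in> ?T \<longleftrightarrow>
      X \<in> ambient U Mt bs d \<and> (\<forall>k\<in>{1..B}. block_form U Mt bs d k P X = 0)" for X
    using dist sub P by (rule tangent_space_iff)
  \<comment> \<open>The candidate normal component: up to a factor 2, the summands without their
    coefficients are the components at \<open>i\<close> of the gradients of the constraint
    functions.\<close>
  define N where "N i = finsum_mat TYPE(complex) (length (bs i) * Mt) (d i)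
         (\<lambda>l. complex_of_real (\<mu> l) \<cdot>\<^sub>m
            (mat_adjoint (W_mat B Mt (bs i)) * Q_mat B Mt l * W_mat B Mt (bs i) * P i))
         (set (bs i))" for i
  define \<eta> where "\<eta> = (\<lambda>i\<in>{1..U}. \<xi> i - N i)"
  have summand: "complex_of_real (\<mu> l) \<cdot>\<^sub>m
      (mat_adjoint (W_mat B Mt (bs i)) * Q_mat B Mt l * W_mat B Mt (bs i) * P i)
      \<in> carrier_mat (length (bs i) * Mt) (d i)" if "i \<in> {1..U}" for i l
    using ambient_carrier[OF P that] by (intro carrier_matI) (auto simp: W_mat_def)
  have N_carrier: "N i \<in> carrier_mat (length (bs i) * Mt) (d i)" if "i \<in> {1..U}" for i
    unfolding N_def using summand[OF that] by (intro finsum_mat_closed) blast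
  then have N_Pi: "N \<in> (\<Pi> i\<in>{1..U}. carrier_mat (length (bs i) * Mt) (d i))"
    by blast
  \<comment> \<open>Row \<open>r\<close> belongs to exactly one block, numbered
    \<open>bs i ! (r div Mt)\<close>, so a single summand of \<open>N i\<close> reaches it and
    supplies its coefficient.\<close>
  have N_index: "N i $$ (r, j) = complex_of_real (\<mu> (bs i ! (r div Mt))) * P i $$ (r, j)"
    if i: "i \<in> {1..U}" and r: "r < length (bs i) * Mt" and j: "j < d i" for i r j
  proof -
    have "N i $$ (r, j) = (\<Sum>l\<in>set (bs i). (complex_of_real (\<mu> l) \<cdot>\<^sub>m
        (mat_adjoint (W_mat B Mt (bs i)) * Q_mat B Mt l * W_mat B Mt (bs i) * P i)) $$ (r, j))"
      unfolding N_def using r j summand[OF i] by (intro index_finsum_mat) auto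
    also have "\<dots> = (\<Sum>l\<in>set (bs i). if bs i ! (r div Mt) = l
        then complex_of_real (\<mu> (bs i ! (r div Mt))) * P i $$ (r, j) else 0)"
    proof (rule sum.cong[OF refl])
      fix l
      have "r < dim_row (mat_adjoint (W_mat B Mt (bs i)) * Q_mat B Mt l * W_mat B Mt (bs i) * P i)"
        "j < dim_col (mat_adjoint (W_mat B Mt (bs i)) * Q_mat B Mt l * W_mat B Mt (bs i) * P i)"
        using ambient_carrier[OF P i] r j by (auto simp: W_mat_def)
      then show "(complex_of_real (\<mu> l) \<cdot>\<^sub>m
        (mat_adjoint (W_mat B Mt (bs i)) * Q_mat B Mt l * W_mat B Mt (bs i) * P i)) $$ (r, j) =
        (if bs i ! (r div Mt) = l
          then complex_of_real (\<mu> (bs i ! (r div Mt))) * P i $$ (r, j) else 0)"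
        by (simp only: index_smult_mat(1)
            index_W_adjoint_Q_W_mult[OF sub[OF i] dist[OF i] ambient_carrier[OF P i] r j]) auto
    qed
    finally show ?thesis using block_index_less[OF r] by simp
  qed
  have "\<eta> \<in> ambient U Mt bs d"
    using minus_carrier_mat[OF N_carrier] unfolding \<eta>_def ambient_def by simp
  moreover have "block_form U Mt bs d k P \<eta> = 0" if k: "k \<in> {1..B}" for k
  proof -
    \<comment> \<open>On the rows that pass the test for \<open>k\<close> the coefficient in
      \<open>N\<close> is constantly \<open>\<mu> k\<close>, so it can be pulled out of the
      form.\<close>
    have "block_form U Mt bs d k P N = \<mu> k * block_form U Mt bs d k P P"
      unfolding block_form_def sum_distrib_left
      by (intro sum.cong refl) (auto simp: N_index algebra_simps)
    \<comment> \<open>The form of \<open>P\<close> with itself is \<open>Pw k\<close>, which is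
      positive and cancels the denominator of \<open>\<mu> k\<close>.\<close>
    also have "\<dots> = block_form U Mt bs d k P \<xi>"
      using assms(8)[OF k] assms(11)[OF k] block_form_trace[OF dist sub P \<xi>, of k]
        power_manifold_block_form[OF dist sub assms(9) k] by simp
    finally show ?thesis
      unfolding \<eta>_def using block_form_diff_right[OF ambient_Pi[OF \<xi>] N_Pi] by simp
  qed
  ultimately have \<eta>_T: "\<eta> \<in> ?T" by (simp add: T_iff)
  have "metric U (\<lambda>i. \<xi> i - \<eta> i) \<zeta> = 0" if \<zeta>: "\<zeta> \<in> ?T" for \<zeta>
  proof -
    have \<zeta>a: "\<zeta> \<in> ambient U Mt bs d" and \<zeta>0: "\<And>k. k \<in> {1..B} \<Longrightarrow> block_form U Mt bs d k P \<zeta> = 0"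
      using \<zeta> by (auto simp: T_iff)
    have "\<xi> i - \<eta> i = N i" if "i \<in> {1..U}" for i
      using that ambient_carrier[OF \<xi> that] N_carrier[OF that]
      by (intro eq_matI) (auto simp: \<eta>_def)
    then have "metric U (\<lambda>i. \<xi> i - \<eta> i) \<zeta> = metric U N \<zeta>" by (simp add: metric_def)
    also have "\<dots> = (\<Sum>i=1..U. \<Sum>j<d i. \<Sum>r<length (bs i) * Mt.
        Re (cnj (\<zeta> i $$ (r, j)) * N i $$ (r, j)))"
      by (rule metric_entries[OF N_Pi ambient_Pi[OF \<zeta>a]])
    \<comment> \<open>Splits each entry by its block number; the inner sum has exactly one matching
      \<open>k\<close> because the block numbers lie in \<open>{1..B}\<close>. Three interchanges
      then bring \<open>k\<close> outermost.\<close>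
    also have "\<dots> = (\<Sum>i=1..U. \<Sum>j<d i. \<Sum>r<length (bs i) * Mt. \<Sum>k=1..B.
        if bs i ! (r div Mt) = k then \<mu> k * Re (cnj (\<zeta> i $$ (r, j)) * P i $$ (r, j)) else 0)"
    proof (intro sum.cong refl)
      fix i j r assume i: "i \<in> {1..U}" and j: "j \<in> {..<d i}" and r: "r \<in> {..<length (bs i) * Mt}"
      have "bs i ! (r div Mt) \<in> {1..B}"
        using sub[OF i] r block_index_less nth_mem by blast
      then show "Re (cnj (\<zeta> i $$ (r, j)) * N i $$ (r, j)) = (\<Sum>k=1..B.
        if bs i ! (r div Mt) = k then \<mu> k * Re (cnj (\<zeta> i $$ (r, j)) * P i $$ (r, j)) else 0)"
        using i j r by (simp add: N_index algebra_simps)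
    qed
    also have "\<dots> = (\<Sum>i=1..U. \<Sum>j<d i. \<Sum>k=1..B. \<Sum>r<length (bs i) * Mt.
        if bs i ! (r div Mt) = k then \<mu> k * Re (cnj (\<zeta> i $$ (r, j)) * P i $$ (r, j)) else 0)"
      by (intro sum.cong refl sum.swap)
    also have "\<dots> = (\<Sum>i=1..U. \<Sum>k=1..B. \<Sum>j<d i. \<Sum>r<length (bs i) * Mt.
        if bs i ! (r div Mt) = k then \<mu> k * Re (cnj (\<zeta> i $$ (r, j)) * P i $$ (r, j)) else 0)"
      by (intro sum.cong refl sum.swap)
    also have "\<dots> = (\<Sum>k=1..B. \<Sum>i=1..U. \<Sum>j<d i. \<Sum>r<length (bs i) * Mt.
        if bs i ! (r div Mt) = k then \<mu> k * Re (cnj (\<zeta> i $$ (r, j)) * P i $$ (r, j)) else 0)"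
      by (rule sum.swap)
    also have "\<dots> = (\<Sum>k=1..B. \<mu> k * block_form U Mt bs d k \<zeta> P)"
      unfolding block_form_def sum_distrib_left by (intro sum.cong refl) auto
    \<comment> \<open>By symmetry of the form, each term contains the tangency condition of
      \<open>\<zeta>\<close> for \<open>k\<close>.\<close>
    also have "\<dots> = 0"
      by (intro sum.neutral) (simp add: block_form_commute[of _ _ _ _ _ \<zeta>] \<zeta>0)
    finally show ?thesis .
  qed
  with \<eta>_T have \<eta>_proj: "is_orth_proj U ?T \<xi> \<eta>" by (simp add: is_orth_proj_def)
  have diff: "(\<lambda>i\<in>{1..U}. X i - Y i) \<in> ?T" if "X \<in> ?T" "Y \<in> ?T" for X Y
  proof -
    have X: "X \<in> ambient U Mt bs d" and Y: "Y \<in> ambient U Mt bs d"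
      using that by (auto simp: T_iff)
    have "(\<lambda>i\<in>{1..U}. X i - Y i) \<in> ambient U Mt bs d"
      using minus_carrier_mat[OF ambient_carrier[OF Y]] unfolding ambient_def by simp
    then show ?thesis
      using that unfolding T_iff block_form_diff_right[OF ambient_Pi[OF X] ambient_Pi[OF Y]] by simp
  qed
  have "?T \<subseteq> ambient U Mt bs d" by (auto simp: tangent_space_def)
  then have unique: "\<eta>' = \<eta>" if "is_orth_proj U ?T \<xi> \<eta>'" for \<eta>'
    using is_orth_proj_unique[OF _ diff \<xi> that \<eta>_proj] by blast
  \<comment> \<open>Existence and uniqueness together give the \<open>THE\<close> in
    \<open>orth_proj\<close> its value.\<close>
  have "orth_proj U ?T \<xi> = \<eta>"
    unfolding orth_proj_def using \<eta>_proj unique by (rule the_equality)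
  then show ?thesis
    using \<eta>_proj unique unfolding \<eta>_def N_def by blast
qed

end
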